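(* Let $n$ be a fixed positive integer, and let $t \in \mathrm{PL}^+(S^1)$ be a homeomorphism which maps rational points to rational points, all of whose break points are rational, and all of whose derivatives (on each of its linear pieces) are of the form $n^q$ with $q \in \mathbb{Z}$ ($q$ may depend on the piece). Suppose that $\mathrm{height}(t) = m$. Then $t$ has a periodic point of period at most $n^m \cdot m$.
   Context: Here $S^1 = \mathbb{R}/\mathbb{Z}$, a point of $S^1$ is rational if it lies in $\mathbb{Q}/\mathbb{Z}$, and $\mathrm{PL}^+(S^1)$ denotes the group of orientation-preserving piecewise linear homeomorphisms of $S^1$ (with finitely many linear pieces). A break point is a point at which the derivative is discontinuous. For a positive integer $m$, consider the subdivision of $S^1$ into the $m$ intervals $\left[\frac{p}{m}, \frac{p+1}{m}\right]$, $0 \le p < m$. This subdivision is called Markov for $t$ if $S^1$ is a union of strips with pairwise disjoint interiors, each strip being a union of consecutive intervals of the subdivision, such that on each strip $t$ acts in one of the following two ways, for some integer $k \ge 0$ depending on the strip: (contraction) the strip consists of $n^k$ consecutive intervals of the subdivision and $t$ takes it linearly onto a single interval of the subdivision; (expansion) the strip is a single interval of the subdivision and $t$ stretches it linearly over $n^k$ consecutive intervals of the subdivision. The height of $t$, denoted $\mathrm{height}(t)$, is the least positive integer $m$ such that the subdivision of $S^1$ into the $m$ intervals $\left[\frac{p}{m}, \frac{p+1}{m}\right]$ is Markov for $t$. (Such an $m$ exists for every $t$ satisfying the hypotheses.) The period of a periodic point $x$ is the least positive integer $j$ with $t^j(x) = x$. *)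

theory Defs
  imports "HOL-Analysis.Analysis"
begin

quotient_type circle = real / "\<lambda>x y :: real. x - y \<in> \<int>"
proof (rule equivpI)
  show "reflp (\<lambda>x y :: real. x - y \<in> \<int>)"
    by (simp add: reflp_def)
  show "symp (\<lambda>x y :: real. x - y \<in> \<int>)"
    unfolding symp_def by (metis Ints_minus minus_diff_eq)
  show "transp (\<lambda>x y :: real. x - y \<in> \<int>)"
  proof (rule transpI)
    fix x y z :: real
    assume "x - y \<in> \<int>" "y - z \<in> \<int>"
    then have "(x - y) + (y - z) \<in> \<int>" by (rule Ints_add)
    then show "x - z \<in> \<int>" by simp
  qed
qed

lift_definition to_circle :: "real \<Rightarrow> circle" is "\<lambda>x. x" .

lemma to_circle_eq_iff: "to_circle x = to_circle y \<longleftrightarrow> x - y \<in> \<int>"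
  by transfer simp

lemma surj_to_circle: "surj to_circle"
  unfolding surj_def by (metis Quotient_circle Quotient_abs_rep to_circle.abs_eq)

text \<open>The topology on the circle is the quotient topology.\<close>

instantiation circle :: topological_space
begin

definition open_circle :: "circle set \<Rightarrow> bool" where
  "open_circle U \<longleftrightarrow> open (to_circle -` U)"

instance
proof
  show "open (UNIV :: circle set)"
    by (simp add: open_circle_def)
  show "open (S \<inter> T)" if "open S" "open T" for S T :: "circle set"
    using that by (simp add: open_circle_def vimage_Int open_Int)
  show "open (\<Union>K)" if "\<forall>S\<in>K. open S" for K :: "circle set set"
    using that by (simp add: open_circle_def vimage_Union open_UN)
qed

end

definition rational_point :: "circle \<Rightarrow> bool" where
  "rational_point x \<longleftrightarrow> x \<in> to_circle ` \<rat>"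

definition circle_lift :: "(circle \<Rightarrow> circle) \<Rightarrow> (real \<Rightarrow> real) \<Rightarrow> bool" where
  "circle_lift t F \<longleftrightarrow>
     continuous_on UNIV F \<and> (\<forall>x. to_circle (F x) = t (to_circle x))"

definition orientation_preserving :: "(circle \<Rightarrow> circle) \<Rightarrow> bool" where
  "orientation_preserving t \<longleftrightarrow> (\<exists>F. circle_lift t F \<and> strict_mono F)"

text \<open>
  On the arc from \<open>a\<close> to \<open>b\<close>, the map \<open>t\<close> is linear with slope \<open>s\<close>, starting at the image of \<open>c\<close>.
\<close>

definition linear_on_arc :: "(circle \<Rightarrow> circle) \<Rightarrow> real \<Rightarrow> real \<Rightarrow> real \<Rightarrow> real \<Rightarrow> bool" where
  "linear_on_arc t a b c s \<longleftrightarrow>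
     (\<forall>x\<in>{a..b}. t (to_circle x) = to_circle (c + s * (x - a)))"

definition piecewise_linear :: "(circle \<Rightarrow> circle) \<Rightarrow> bool" where
  "piecewise_linear t \<longleftrightarrow>
     (\<exists>\<A>. finite \<A> \<and> \<Union>\<A> = UNIV \<and>
        (\<forall>A\<in>\<A>. \<exists>a b c s. A = to_circle ` {a..b} \<and> linear_on_arc t a b c s))"

definition PL_plus :: "(circle \<Rightarrow> circle) set" where
  "PL_plus = {t. (\<exists>g. homeomorphism UNIV UNIV t g) \<and>
                 orientation_preserving t \<and> piecewise_linear t}"

text \<open>
  Two lifts of the same map differ by an integer constant, so derivatives and break points
  do not depend on the lift.  At a break point of a piecewise linear map the value of
  \<^const>\<open>deriv\<close> is unspecified, but its left and right limits there differ, so it is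
  discontinuous in any case.
\<close>

definition has_circle_derivative :: "(circle \<Rightarrow> circle) \<Rightarrow> real \<Rightarrow> circle \<Rightarrow> bool" where
  "has_circle_derivative t D x \<longleftrightarrow>
     (\<exists>F y. circle_lift t F \<and> to_circle y = x \<and> (F has_real_derivative D) (at y))"

definition break_point :: "(circle \<Rightarrow> circle) \<Rightarrow> circle \<Rightarrow> bool" where
  "break_point t x \<longleftrightarrow>
     (\<exists>F y. circle_lift t F \<and> to_circle y = x \<and> \<not> isCont (deriv F) y)"

text \<open>
  The index \<open>p\<close> of a subdivision interval is an arbitrary integer and only matters modulo \<open>m\<close>;
  consecutive means cyclically consecutive, so that a strip may contain \<open>0\<close> in its interior.
\<close>

definition subdivision_interval :: "nat \<Rightarrow> int \<Rightarrow> circle set" where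
  "subdivision_interval m p =
     to_circle ` {real_of_int p / real m .. (real_of_int p + 1) / real m}"

definition consecutive_intervals :: "nat \<Rightarrow> int \<Rightarrow> nat \<Rightarrow> circle set" where
  "consecutive_intervals m p l = (\<Union>j<l. subdivision_interval m (p + int j))"

text \<open>
  Linearity onto an interval, or onto a union of consecutive ones, is expressed by the initial
  point and the slope rather than by the image set, so that end points go to end points even
  when \<open>m = 1\<close>, where the only interval is the whole circle as a set.
\<close>

definition contraction_strip ::
    "nat \<Rightarrow> nat \<Rightarrow> (circle \<Rightarrow> circle) \<Rightarrow> circle set \<Rightarrow> bool" where
  "contraction_strip n m t S \<longleftrightarrow>
     (\<exists>(p :: int) (r :: int) (k :: nat).
        S = consecutive_intervals m p (n ^ k) \<and>
        linear_on_arc t (real_of_int p / real m) ((real_of_int p + real n ^ k) / real m)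
          (real_of_int r / real m) (1 / real n ^ k))"

definition expansion_strip ::
    "nat \<Rightarrow> nat \<Rightarrow> (circle \<Rightarrow> circle) \<Rightarrow> circle set \<Rightarrow> bool" where
  "expansion_strip n m t S \<longleftrightarrow>
     (\<exists>(p :: int) (r :: int) (k :: nat).
        S = subdivision_interval m p \<and>
        linear_on_arc t (real_of_int p / real m) ((real_of_int p + 1) / real m)
          (real_of_int r / real m) (real n ^ k))"

definition markov :: "nat \<Rightarrow> nat \<Rightarrow> (circle \<Rightarrow> circle) \<Rightarrow> bool" where
  "markov n m t \<longleftrightarrow>
     (\<exists>\<S>. \<Union>\<S> = UNIV \<and>
        pairwise (\<lambda>A B. interior A \<inter> interior B = {}) \<S> \<and>
        (\<forall>S\<in>\<S>. contraction_strip n m t S \<or> expansion_strip n m t S))"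

definition height :: "nat \<Rightarrow> (circle \<Rightarrow> circle) \<Rightarrow> nat" where
  "height n t = (LEAST m. 0 < m \<and> markov n m t)"

definition periodic_point :: "('a \<Rightarrow> 'a) \<Rightarrow> 'a \<Rightarrow> bool" where
  "periodic_point t x \<longleftrightarrow> (\<exists>j>0. (t ^^ j) x = x)"

definition period :: "('a \<Rightarrow> 'a) \<Rightarrow> 'a \<Rightarrow> nat" where
  "period t x = (LEAST j. 0 < j \<and> (t ^^ j) x = x)"

end

theory Submission imports Defs begin

text \<open>
  The idea is to follow one grid point of the Markov subdivision and to watch its denominator.

  Measure the circle in units of \<open>1 / m\<close>, so that the grid points are the integers modulo \<open>m\<close>, and
  follow the orbit of \<open>0\<close>.  A contraction by \<open>n ^ k\<close> multiplies the denominator of a point by at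
  most \<open>n ^ k\<close>, and an expansion by \<open>n ^ k\<close> cancels that many factors, as far as they are there.
  So every point of the orbit has a denominator \<open>n ^ e\<close>, and \<open>e\<close> is called its level.

  If the denominators \<open>n ^ m\<close> suffice for the first \<open>n ^ m * m + 1\<close> points, then two of these points
  coincide, as there are only \<open>n ^ m * m\<close> points with such a denominator (\<open>return_if_grid_bounded\<close>).

  Otherwise the level exceeds \<open>m\<close> at some time \<open>i \<le> n ^ m * m\<close>, and \<open>n \<ge> 2\<close>.  For each \<open>h \<le> m\<close> consider
  the last time before \<open>i\<close> at which the level is at most \<open>h\<close>.  At this time a contraction lifts the
  level past \<open>h\<close>, where it stays up to time \<open>i\<close>.  The strip that it contracts consists of \<open>n ^ k\<close>
  intervals, and among its aligned blocks of \<open>n\<close>, \<open>n ^ 2\<close>, ..., \<open>n ^ k\<close> intervals there is one around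
  the orbit point whose exponent is exactly the rise that leads from the level before the
  contraction to \<open>h + 1\<close>.  Since the level stays above \<open>h\<close>, no later expansion outweighs this rise,
  and all iterates up to time \<open>i\<close> are linear on the block, with images inside single intervals
  (\<open>block_follow\<close>).

  All blocks together number at most \<open>m\<close>, because a block is determined by the grid point that
  ends the first of its \<open>n\<close> equal parts (\<open>split_point_determines_block\<close>).  So two of the \<open>m + 1\<close>
  values of \<open>h\<close> lead to the same block, at different times.  The iterate of \<open>t\<close> between these times
  maps the block linearly into itself and has a fixed point (\<open>block_return\<close>).

  It remains to see that Markov subdivisions exist (\<open>markov_exists\<close>).  Rational breaks and slopes
  \<open>n ^ q\<close> make a lift of \<open>t\<close> affine on the intervals of some rational grid, and its values at the
  grid points are rational because \<open>t\<close> preserves rational points.  Refining the grid by a common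
  denominator of these values and by a large power of \<open>n\<close> makes it Markov.
\<close>

section \<open>Maps of the circle that are linear on an arc\<close>

lemma to_circle_add_int: "w \<in> \<int> \<Longrightarrow> to_circle (x + w) = to_circle x"
  by (simp add: to_circle_eq_iff)

text \<open>The difference between a lift and the affine function that represents \<open>t\<close> on the arc is
  continuous and takes integer values, hence is constant.\<close>

lemma lift_affine_on_arc:
  assumes "circle_lift t F" "linear_on_arc t a b c s"
  obtains d where "\<And>x. x \<in> {a..b} \<Longrightarrow> F x = d + s * x"
proof -
  define g where "g x = F x - (c + s * (x - a))" for x
  have g_int: "g x \<in> \<int>" if "x \<in> {a..b}" for x
  proof -
    have "to_circle (F x) = t (to_circle x)" using assms(1) by (simp add: circle_lift_def)
    also have "\<dots> = to_circle (c + s * (x - a))"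
      using assms(2) that by (auto simp: linear_on_arc_def)
    finally show ?thesis by (simp only: to_circle_eq_iff g_def)
  qed
  have "continuous_on {a..b} F"
    using assms(1) by (auto simp: circle_lift_def intro: continuous_on_subset)
  then have "continuous_on {a..b} g" unfolding g_def by (intro continuous_intros)
  then have "g constant_on {a..b}"
  proof (rule continuous_discrete_range_constant[OF connected_Icc])
    fix x assume x: "x \<in> {a..b}"
    have "1 \<le> norm (g y - g x)" if "y \<in> {a..b}" "g y \<noteq> g x" for y
      using Ints_nonzero_abs_less1[OF Ints_diff[OF g_int[OF that(1)] g_int[OF x]]] that(2)
      by force
    then show "\<exists>e>0. \<forall>y. y \<in> {a..b} \<and> g y \<noteq> g x \<longrightarrow> e \<le> norm (g y - g x)"
      by (intro exI[of _ 1]) auto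
  qed
  then obtain k where "\<And>x. x \<in> {a..b} \<Longrightarrow> g x = k" unfolding constant_on_def by blast
  then have "F x = (k + c - s * a) + s * x" if "x \<in> {a..b}" for x
    using that by (force simp: g_def algebra_simps)
  then show thesis by (rule that)
qed

lemma linear_on_arc_shift:
  assumes "linear_on_arc t a b c s"
  shows "linear_on_arc t (a + of_int j) (b + of_int j) c s"
  unfolding linear_on_arc_def
proof
  fix x assume x: "x \<in> {a + real_of_int j..b + real_of_int j}"
  have "to_circle x = to_circle (x - of_int j)" by (simp add: to_circle_eq_iff)
  moreover have "x - of_int j \<in> {a..b}" using x by auto
  then have "t (to_circle (x - of_int j)) = to_circle (c + s * (x - of_int j - a))"
    using assms unfolding linear_on_arc_def by blast
  ultimately show "t (to_circle x) = to_circle (c + s * (x - (a + of_int j)))"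
    by (simp add: algebra_simps)
qed

section \<open>Rational breaks and slopes give linearity on a rational grid\<close>

lemma finite_int_translates: "finite {x \<in> {u..v}. x - c \<in> \<int>}" for u v c :: real
proof (rule finite_subset)
  show "{x \<in> {u..v}. x - c \<in> \<int>} \<subseteq> (\<lambda>j. c + of_int j) ` {\<lfloor>u - c\<rfloor>..\<lceil>v - c\<rceil>}"
  proof clarify
    fix x assume x: "x \<in> {u..v}" "x - c \<in> \<int>"
    then obtain j where j: "x - c = of_int j" by (auto elim: Ints_cases)
    then have "u - c \<le> of_int j" "of_int j \<le> v - c" using x(1) by auto
    then have "\<lfloor>u - c\<rfloor> \<le> j" "j \<le> \<lceil>v - c\<rceil>" by linarith+
    then show "x \<in> (\<lambda>j. c + of_int j) ` {\<lfloor>u - c\<rfloor>..\<lceil>v - c\<rceil>}"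
      using j by (intro image_eqI[of _ _ j]) auto
  qed
qed simp

lemma common_denominator:
  assumes "finite X" "X \<subseteq> \<rat>"
  obtains M :: nat where "0 < M" "\<And>x. x \<in> X \<Longrightarrow> real M * x \<in> \<int>"
proof -
  from assms have "\<exists>M>0. \<forall>x\<in>X. real M * x \<in> \<int>"
  proof (induction X)
    case (insert x X)
    then obtain M where M: "0 < M" "\<forall>x\<in>X. real M * x \<in> \<int>" by auto
    obtain c d :: int where cd: "0 < d" "x = of_int c / of_int d"
      using insert.prems by (auto elim: Rats_cases')
    have "real (M * nat d) * y \<in> \<int>" if "y \<in> insert x X" for y
    proof (cases "y = x")
      case True
      then have "real (M * nat d) * y = of_int (int M * c)" using cd by simp
      then show ?thesis by (metis Ints_of_int)
    next
      case False
      then have "real M * y \<in> \<int>" using M that by blast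
      then have "of_int d * (real M * y) \<in> \<int>" by (intro Ints_mult[of "of_int d"]) auto
      then show ?thesis using cd by (simp add: mult_ac)
    qed
    then show ?case using M cd by (intro exI[of _ "M * nat d"]) auto
  qed (auto intro: exI[of _ 1])
  then show thesis using that by blast
qed

text \<open>Away from \<open>E\<close> the derivative takes finitely many values, and on \<open>E\<close> it can only add finitely
  many more.  A continuous function with finite range on an interval is constant, so there is one
  slope, and the continuity of \<open>F\<close> carries the affine formula across the points of \<open>E\<close>.\<close>

lemma affine_if_deriv_continuous:
  fixes F :: "real \<Rightarrow> real"
  assumes "u < v" "continuous_on {u..v} F" "continuous_on {u<..<v} (deriv F)"
    and "finite E" "finite S"
    and slopes: "\<And>x. x \<in> {u<..<v} - E \<Longrightarrow> \<exists>s\<in>S. (F has_real_derivative s) (at x)"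
  obtains s where "\<And>x. x \<in> {u..v} \<Longrightarrow> F x = F u + s * (x - u)"
    "\<exists>x. (F has_real_derivative s) (at x)"
proof -
  have "deriv F ` {u<..<v} \<subseteq> S \<union> deriv F ` E"
  proof clarify
    fix x assume "x \<in> {u<..<v}" "deriv F x \<notin> deriv F ` E"
    then have "x \<in> {u<..<v} - E" by blast
    from slopes[OF this] show "deriv F x \<in> S" using DERIV_imp_deriv by force
  qed
  then have "finite (deriv F ` {u<..<v})" using assms(4,5) by (auto intro: finite_subset)
  then have "deriv F constant_on {u<..<v}"
    using assms(3) by (intro continuous_finite_range_constant) auto
  then obtain s where "\<And>x. x \<in> {u<..<v} \<Longrightarrow> deriv F x = s" unfolding constant_on_def by blast
  then have der: "(F has_real_derivative s) (at x)" if "x \<in> {u<..<v} - E" for x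
    using slopes[OF that] that DERIV_imp_deriv by fastforce
  define g where "g x = F x - s * (x - u)" for x
  have "g x = g u" if "x \<in> {u..v}" for x
  proof (rule has_derivative_zero_unique_strong_interval[where f = g and k = "E \<union> {u, v}" and a = u and b = v])
    show "continuous_on {u..v} g" unfolding g_def using assms(2) by (intro continuous_intros)
    fix y assume "y \<in> {u..v} - (E \<union> {u, v})"
    then have "(F has_real_derivative s) (at y)" by (intro der) auto
    then have "(g has_real_derivative 0) (at y)"
      unfolding g_def by (auto intro!: derivative_eq_intros)
    then show "(g has_derivative (\<lambda>h. 0)) (at y within {u..v})"
      by (simp add: has_field_derivative_def lambda_zero has_derivative_at_withinI)
  qed (use assms that in auto)
  then have "F x = F u + s * (x - u)" if "x \<in> {u..v}" for x
    using that by (force simp: g_def)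
  moreover have "infinite {u<..<v}" using assms(1) by simp
  then have "{u<..<v} - E \<noteq> {}" using assms(4) by (metis Diff_eq_empty_iff finite_subset)
  then have "\<exists>x. (F has_real_derivative s) (at x)" using der by blast
  ultimately show thesis by (rule that)
qed

text \<open>The arcs of a piecewise linear map may end at irrational points, but such an end is not a break
  point, so the derivative is continuous there.  A common denominator of the rational ends
  therefore gives a grid with a single slope on each of its intervals.\<close>

lemma affine_on_rational_grid:
  assumes lift: "circle_lift t F" and "piecewise_linear t"
    and rat: "\<And>x. break_point t x \<Longrightarrow> rational_point x"
  obtains M :: nat and s :: "nat \<Rightarrow> real" where "0 < M"
    "\<And>j x. j < M \<Longrightarrow> x \<in> {real j / M..(real j + 1) / M} \<Longrightarrow> F x = F (real j / M) + s j * (x - real j / M)"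
    "\<And>j. j < M \<Longrightarrow> \<exists>x. (F has_real_derivative s j) (at x)"
proof -
  from assms(2) obtain \<A> where fin: "finite \<A>" and cover: "\<Union>\<A> = UNIV"
    and "\<forall>A\<in>\<A>. \<exists>a b c s. A = to_circle ` {a..b} \<and> linear_on_arc t a b c s"
    unfolding piecewise_linear_def by (elim exE conjE)
  from this(3) obtain a b c s where
    arc: "\<And>A. A \<in> \<A> \<Longrightarrow> A = to_circle ` {a A..b A} \<and> linear_on_arc t (a A) (b A) (c A) (s A)"
    by metis
  have cont: "continuous_on X F" for X
    using lift unfolding circle_lift_def by (elim conjE) (rule continuous_on_subset[OF _ subset_UNIV])
  \<comment> \<open>The lifts of all end points of arcs.\<close>
  define E where "E = {x. \<exists>A\<in>\<A>. x - a A \<in> \<int> \<or> x - b A \<in> \<int>}"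
  have fin_E: "finite (E \<inter> {u..v})" for u v
  proof -
    have "E \<inter> {u..v} = (\<Union>A\<in>\<A>. {x \<in> {u..v}. x - a A \<in> \<int>} \<union> {x \<in> {u..v}. x - b A \<in> \<int>})"
      by (auto simp: E_def)
    then show ?thesis using fin finite_int_translates by auto
  qed
  have local: "\<exists>A\<in>\<A>. \<exists>u v. x \<in> {u<..<v} \<and> (\<forall>y\<in>{u<..<v}. (F has_real_derivative s A) (at y))"
    if "x \<notin> E" for x
  proof -
    obtain A where A: "A \<in> \<A>" "to_circle x \<in> A" using cover by (metis UNIV_I UnionE)
    then obtain z where z: "z \<in> {a A..b A}" "to_circle x = to_circle z" using arc by blast
    then obtain j where j: "x - z = of_int j" by (auto simp: to_circle_eq_iff elim: Ints_cases)
    let ?u = "a A + of_int j" and ?v = "b A + of_int j"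
    obtain d where d: "\<And>y. y \<in> {?u..?v} \<Longrightarrow> F y = d + s A * y"
      using lift_affine_on_arc[OF lift linear_on_arc_shift] arc[OF A(1)] by metis
    have "x \<noteq> ?u" "x \<noteq> ?v" using that A(1) by (auto simp: E_def)
    moreover have "?u \<le> x" "x \<le> ?v" using z(1) j by auto
    ultimately have "x \<in> {?u<..<?v}" by simp
    moreover have "(F has_real_derivative s A) (at y)" if y: "y \<in> {?u<..<?v}" for y
    proof (rule DERIV_cong_ev[THEN iffD2])
      show "y = y" by simp
      show "((\<lambda>y. d + s A * y) has_real_derivative s A) (at y)"
        by (auto intro!: derivative_eq_intros)
      show "\<forall>\<^sub>F y in nhds y. F y = d + s A * y"
        using eventually_nhds_in_open[OF open_greaterThanLessThan y]
        by (rule eventually_mono) (auto intro: d)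
    qed simp
    ultimately show ?thesis using A(1) by blast
  qed
  have "finite (E \<inter> {0..1} \<inter> \<rat>)" using fin_E by blast
  then obtain M where M: "0 < M" "\<And>x. x \<in> E \<inter> {0..1} \<inter> \<rat> \<Longrightarrow> real M * x \<in> \<int>"
    by (rule common_denominator) auto
  define affine where "affine j \<sigma> \<longleftrightarrow>
      (\<forall>x\<in>{real j / M..(real j + 1) / M}. F x = F (real j / M) + \<sigma> * (x - real j / M)) \<and>
      (\<exists>x. (F has_real_derivative \<sigma>) (at x))" for j \<sigma>
  have "\<forall>j\<in>{..<M}. \<exists>\<sigma>. affine j \<sigma>"
  proof
    fix j assume "j \<in> {..<M}"
    then have j: "j < M" by simp
    let ?u = "real j / M" and ?v = "(real j + 1) / M"
    have "?u < ?v" using M by (simp add: divide_strict_right_mono)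
    have "real (j + 1) \<le> real M" using j by linarith
    then have uv: "0 \<le> ?u" "?v \<le> 1" using M by simp_all
    have "isCont (deriv F) x" if x: "x \<in> {?u<..<?v}" for x
    proof (cases "x \<in> E")
      case True
      have "x \<notin> \<rat>"
      proof
        assume "x \<in> \<rat>"
        moreover have "?u < x" "x < ?v" using x by simp_all
        then have "0 \<le> x" "x \<le> 1" using uv by linarith+
        ultimately have "real M * x \<in> \<int>" using M(2) True by simp
        then obtain z where z: "real M * x = of_int z" by (auto elim: Ints_cases)
        have "real j < real M * x" "real M * x < real j + 1" using x M(1) by (simp_all add: field_simps)
        then have "real_of_int (int j) < of_int z" "of_int z < real_of_int (int j + 1)"
          unfolding z by simp_all
        then show False unfolding of_int_less_iff by linarith
      qed
      moreover have "y \<in> \<rat>" if "to_circle x = to_circle y" "x \<in> \<rat>" for x y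
        using that by (metis Ints_subset_Rats Rats_diff diff_diff_eq2 add_diff_cancel_left' subsetD to_circle_eq_iff)
      ultimately have "\<not> rational_point (to_circle x)" unfolding rational_point_def by (metis imageE)
      then show ?thesis using rat lift unfolding break_point_def by blast
    next
      case False
      then obtain A u v where uv: "x \<in> {u<..<v}" and "\<forall>y\<in>{u<..<v}. (F has_real_derivative s A) (at y)"
        using local by blast
      then have "deriv F y = s A" if "y \<in> {u<..<v}" for y using that DERIV_imp_deriv by blast
      then have "continuous_on {u<..<v} (deriv F)"
        by (intro continuous_on_eq[OF continuous_on_const[of _ "s A"]]) simp
      then show ?thesis using uv by (simp add: continuous_on_eq_continuous_at)
    qed
    then have "continuous_on {?u<..<?v} (deriv F)" by (simp add: continuous_on_eq_continuous_at)
    then show "\<exists>\<sigma>. affine j \<sigma>"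
    proof (rule affine_if_deriv_continuous[OF \<open>?u < ?v\<close> cont])
      show "finite (E \<inter> {?u..?v})" by (rule fin_E)
      show "finite (s ` \<A>)" using fin by simp
      show "\<exists>\<sigma>\<in>s ` \<A>. (F has_real_derivative \<sigma>) (at x)" if "x \<in> {?u<..<?v} - E \<inter> {?u..?v}" for x
      proof -
        have "x \<notin> E" using that by auto
        from local[OF this] show ?thesis by blast
      qed
    qed (unfold affine_def, blast)
  qed
  from bchoice[OF this] obtain \<sigma> where \<sigma>: "\<forall>j\<in>{..<M}. affine j (\<sigma> j)" by (elim exE)
  have aff: "affine j (\<sigma> j)" if "j < M" for j using \<sigma> that by simp
  show thesis
  proof (rule that[OF M(1)])
    show "\<exists>x. (F has_real_derivative \<sigma> j) (at x)" if "j < M" for j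
      using aff[OF that] unfolding affine_def by (rule conjunct2)
    show "F x = F (real j / M) + \<sigma> j * (x - real j / M)"
      if "j < M" "x \<in> {real j / M..(real j + 1) / M}" for j x
      using conjunct1[OF aff[OF that(1), unfolded affine_def]] that(2) by (rule bspec)
  qed
qed

section \<open>A Markov subdivision exists\<close>

text \<open>An open subset of the circle contains an irrational point, and such a point lies in exactly one
  interval of the subdivision.\<close>

lemma common_interval_if_interiors_meet:
  assumes "0 < m" "s + W \<le> m" "s' + W' \<le> m"
    and meet: "interior (consecutive_intervals m (int s) W) \<inter>
               interior (consecutive_intervals m (int s') W') \<noteq> {}"
  obtains Q :: nat where "s \<le> Q" "Q < s + W" "s' \<le> Q" "Q < s' + W'"
proof -
  let ?U = "interior (consecutive_intervals m (int s) W) \<inter> interior (consecutive_intervals m (int s') W')"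
  have "open (to_circle -` ?U)" by (simp flip: open_circle_def add: open_Int)
  moreover have "to_circle -` ?U \<noteq> {}" using meet surj_to_circle by (metis ex_in_conv surjD vimageI)
  ultimately obtain z where z: "to_circle z \<in> ?U" "z \<notin> \<rat>"
    using open_minus_countable[OF countable_rat] by (metis vimageD)
  have *: "p \<le> nat \<lfloor>real m * frac z\<rfloor> \<and> nat \<lfloor>real m * frac z\<rfloor> < p + l"
    if "to_circle z \<in> consecutive_intervals m (int p) l" "p + l \<le> m" for p l
  proof -
    from that(1) obtain i y where i: "i < l" "real (p + i) / m \<le> y" "y \<le> (real (p + i) + 1) / m"
      and eq: "to_circle z = to_circle y"
      by (auto simp: consecutive_intervals_def subdivision_interval_def)
    from eq obtain w where w: "z - y = of_int w" by (auto simp: to_circle_eq_iff elim: Ints_cases)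
    have y_irr: "y \<notin> \<rat>"
    proof
      assume "y \<in> \<rat>"
      then have "y + of_int w \<in> \<rat>" by simp
      then show False using z(2) w by (metis add.commute diff_add_cancel)
    qed
    have "real (p + i) + 1 \<le> real m" using i(1) that(2) by linarith
    then have "(real (p + i) + 1) / m \<le> 1" using assms(1) by simp
    moreover have "0 \<le> real (p + i) / m" by simp
    moreover have "y \<noteq> 0" "y \<noteq> 1" using y_irr by auto
    ultimately have "0 \<le> y" "y < 1" using i by linarith+
    then have "frac z = y" using w by (simp add: frac_unique_iff) 
    moreover have "real m * y \<noteq> real (p + i) + 1"
    proof
      assume "real m * y = real (p + i) + 1"
      then have "y = (real (p + i) + 1) / m" using assms(1) by (simp add: field_simps)
      then show False using y_irr by simp
    qed
    moreover have "real (p + i) \<le> real m * y" "real m * y \<le> real (p + i) + 1"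
      using i assms(1) by (simp_all add: field_simps)
    ultimately have "\<lfloor>real m * frac z\<rfloor> = int (p + i)" by (intro floor_unique) auto
    then have "nat \<lfloor>real m * frac z\<rfloor> = p + i" by (simp only: nat_int)
    then show ?thesis using i(1) by simp
  qed
  have "to_circle z \<in> consecutive_intervals m (int s) W" "to_circle z \<in> consecutive_intervals m (int s') W'"
    using z(1) interior_subset by blast+
  then show thesis using * assms(2,3) that by blast
qed

text \<open>The grid of step \<open>1 / M\<close> is refined by the factor \<open>D\<close>.  Since the image of every vertex lies on the
  refined grid, an expanding piece maps each small interval onto a run of small intervals; since
  \<open>D\<close> is a multiple of \<open>n ^ e j\<close>, a contracting piece splits evenly into strips of \<open>n ^ e j\<close>
  small intervals, and each strip goes onto one.\<close>

lemma markov_if_affine_on_grid: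
  fixes M D n :: nat and e k :: "nat \<Rightarrow> nat"
  assumes "0 < M" "0 < D" "0 < n" "circle_lift t F"
    and slope: "\<And>j x. j < M \<Longrightarrow> x \<in> {real j / M..(real j + 1) / M} \<Longrightarrow>
      F x = F (real j / M) + (real n ^ k j / real n ^ e j) * (x - real j / M)"
    and one_sided: "\<And>j. j < M \<Longrightarrow> e j = 0 \<or> k j = 0"
    and vertex: "\<And>j. j < M \<Longrightarrow> real (M * D) * F (real j / M) \<in> \<int>"
    and divides: "\<And>j. j < M \<Longrightarrow> n ^ e j dvd D"
  shows "markov n (M * D) t"
proof -
  define m where "m = M * D"
  have m: "0 < m" using assms by (simp add: m_def)
  \<comment> \<open>The strip around the small interval \<open>P\<close> has \<open>W P\<close> intervals and starts at \<open>s P\<close>.  Rounding \<open>P\<close> down to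
    a multiple of \<open>W P\<close> stays within the same coarse interval because \<open>W P\<close> divides \<open>D\<close>.\<close>
  define W where "W P = n ^ e (P div D)" for P
  define s where "s P = W P * (P div W P)" for P
  define S where "S P = consecutive_intervals m (int (s P)) (W P)" for P
  have W_pos: "0 < W P" for P using assms(3) by (simp add: W_def)
  have s_mod: "P = s P + P mod W P" for P by (simp add: s_def)
  have s_le: "s P \<le> P" and P_less: "P < s P + W P" for P
    using s_mod[of P] mod_less_divisor[OF W_pos, of P P] by linarith+
  have j_less: "P div D < M" if "P < m" for P
    using that assms(2) by (simp add: m_def less_mult_imp_div_less)
  have block: "P div D * D \<le> s P" "s P + W P \<le> (P div D + 1) * D" if P: "P < m" for P
  proof -
    obtain d where d: "D = W P * d" using divides[OF j_less[OF P]] by (auto simp: W_def)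
    have "P div D * D \<le> P" by simp
    then have "W P * (P div D * d) < W P * (P div W P + 1)"
      using P_less[of P] by (simp add: d s_def mult_ac)
    then have "P div D * d < P div W P + 1" unfolding mult_less_cancel1 by blast
    then have "W P * (P div D * d) \<le> W P * (P div W P)" by (intro mult_left_mono) auto
    then show "P div D * D \<le> s P" by (metis d mult.left_commute s_def)
    have "P < (P div D + 1) * D"
      using assms(2) by (metis add.commute dividend_less_div_times mult.commute mult_Suc plus_1_eq_Suc)
    then have "W P * (P div W P) < W P * ((P div D + 1) * d)"
      using s_le[of P] by (metis d le_less_trans mult.left_commute s_def)
    then have "P div W P < (P div D + 1) * d" unfolding mult_less_cancel1 by blast
    then have "P div W P + 1 \<le> (P div D + 1) * d" by linarith
    then have "W P * (P div W P + 1) \<le> W P * ((P div D + 1) * d)" by (intro mult_left_mono) auto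
    then show "s P + W P \<le> (P div D + 1) * D" by (metis d distrib_left mult.left_commute mult.right_neutral s_def)
  qed
  have strip: "contraction_strip n m t (S P) \<or> expansion_strip n m t (S P)" if P: "P < m" for P
  proof -
    define j where "j = P div D"
    note j = j_less[OF P, folded j_def]
    define \<sigma> where "\<sigma> = real n ^ k j / real n ^ e j"
    have "W P dvd s P - j * D"
      using divides[OF j] by (intro dvd_diff_nat dvd_mult) (auto simp: s_def W_def j_def)
    then obtain d where d: "s P - j * D = W P * d" by (elim dvdE)
    then have s_eq: "real (s P) = real j * D + real (W P) * d"
      using block(1)[OF P] by (metis j_def le_add_diff_inverse of_nat_add of_nat_mult)
    have "real m * F (real j / M) + real n ^ k j * d \<in> \<int>"
      using vertex[OF j] by (intro Ints_add) (auto simp: m_def)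
    then obtain r where r: "real m * F (real j / M) + real n ^ k j * d = of_int r"
      by (rule Ints_cases)
    have "linear_on_arc t (of_int (int (s P)) / m) ((of_int (int (s P)) + real (W P)) / m) (of_int r / m) \<sigma>"
      unfolding linear_on_arc_def
    proof
      fix x assume x: "x \<in> {of_int (int (s P)) / real m..(of_int (int (s P)) + real (W P)) / m}"
      have jM: "real j / M = real (j * D) / m" "(real j + 1) / M = real ((j + 1) * D) / m"
        using assms(1,2) by (simp_all add: m_def field_simps)
      have "real (j * D) / m \<le> real (s P) / m" "real (s P + W P) / m \<le> real ((j + 1) * D) / m"
        using block[OF P] unfolding j_def by (intro divide_right_mono; simp only: of_nat_le_iff of_nat_0_le_iff)+
      then have "x \<in> {real j / M..(real j + 1) / M}"
        using x unfolding jM by simp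
      from slope[OF j this, folded \<sigma>_def] have "F x = F (real j / M) + \<sigma> * (real (s P) / m - real j / M) + \<sigma> * (x - real (s P) / m)"
        by (simp add: algebra_simps)
      also have "real (s P) / m - real j / M = real (W P) * d / m"
        unfolding s_eq jM by (simp add: add_divide_distrib)
      also have "F (real j / M) + \<sigma> * (real (W P) * d / m) = of_int r / m"
        using m assms(3) by (simp add: \<sigma>_def W_def j_def[symmetric] field_simps flip: r)
      finally have Fx: "F x = of_int r / m + \<sigma> * (x - real (s P) / m)" .
      have "t (to_circle x) = to_circle (F x)" using assms(4) by (simp add: circle_lift_def)
      then show "t (to_circle x) = to_circle (of_int r / m + \<sigma> * (x - of_int (int (s P)) / m))"
        by (simp add: Fx)
    qed
    note lin = this
    from one_sided[OF j] show ?thesis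
    proof
      assume "k j = 0"
      then have "contraction_strip n m t (S P)"
        unfolding contraction_strip_def S_def using lin
        by (intro exI[of _ "int (s P)"] exI[of _ r] exI[of _ "e j"]) (simp add: \<sigma>_def W_def j_def)
      then show ?thesis ..
    next
      assume "e j = 0"
      then have "expansion_strip n m t (S P)"
        unfolding expansion_strip_def S_def using lin
        by (intro exI[of _ "int (s P)"] exI[of _ r] exI[of _ "k j"])
          (simp add: \<sigma>_def W_def j_def consecutive_intervals_def lessThan_Suc)
      then show ?thesis ..
    qed
  qed
  have S_eq: "S P = S Q" if "P < m" "s P \<le> Q" "Q < s P + W P" for P Q
  proof -
    have "P div D * D \<le> Q" "Q < (P div D + 1) * D" using block[OF that(1)] that by linarith+
    then have "Q div D = P div D" using assms(2) by (intro div_nat_eqI) (simp_all add: algebra_simps)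
    then have W: "W Q = W P" by (simp add: W_def)
    have "Q div W P = P div W P"
      using that(2,3) by (intro div_nat_eqI) (simp_all add: s_def algebra_simps)
    then show ?thesis by (simp add: S_def s_def W)
  qed
  show ?thesis
    unfolding markov_def m_def[symmetric]
  proof (intro exI[of _ "S ` {..<m}"] conjI)
    show "\<Union> (S ` {..<m}) = UNIV"
    proof (rule UNIV_eq_I[symmetric])
      fix c
      obtain z where z: "c = to_circle z" using surj_to_circle by (metis surjD)
      define P where "P = nat \<lfloor>real m * frac z\<rfloor>"
      have "0 \<le> real m * frac z" using m by simp
      then have P: "real P \<le> real m * frac z" "real m * frac z < real P + 1"
        unfolding P_def by linarith+
      moreover have "real m * frac z < real m * 1" using m frac_lt_1 by (intro mult_strict_left_mono) auto
      ultimately have "P < m" by linarith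
      have "c = to_circle (frac z)" unfolding z by (simp add: to_circle_eq_iff frac_def)
      moreover have "frac z \<in> {real P / m..(real P + 1) / m}"
        using P m by (simp add: field_simps)
      ultimately have "c \<in> subdivision_interval m (int (s P) + int (P - s P))"
        using s_le[of P] by (auto simp: subdivision_interval_def simp flip: of_nat_add)
      moreover have "P - s P < W P" using s_le[of P] P_less[of P] by linarith
      ultimately have "c \<in> S P" unfolding S_def consecutive_intervals_def by blast
      then show "c \<in> \<Union> (S ` {..<m})" using \<open>P < m\<close> by blast
    qed
    show "pairwise (\<lambda>A B. interior A \<inter> interior B = {}) (S ` {..<m})"
    proof (rule pairwiseI)
      fix A B assume "A \<in> S ` {..<m}" "B \<in> S ` {..<m}" "A \<noteq> B"
      then obtain P P' where P: "P < m" "A = S P" "P' < m" "B = S P'" by auto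
      have "s P + W P \<le> m" if "P < m" for P
      proof -
        have "(P div D + 1) * D \<le> m" using j_less[OF that] unfolding m_def by (intro mult_right_mono) auto
        then show ?thesis using block(2)[OF that] by linarith
      qed
      note bound = this
      show "interior A \<inter> interior B = {}"
      proof (rule ccontr)
        assume "interior A \<inter> interior B \<noteq> {}"
        then obtain Q where "s P \<le> Q" "Q < s P + W P" "s P' \<le> Q" "Q < s P' + W P'"
          using common_interval_if_interiors_meet[OF m bound[OF P(1)] bound[OF P(3)]]
          unfolding P S_def by metis
        then have "A = B" using S_eq P by metis
        with \<open>A \<noteq> B\<close> show False ..
      qed
    qed
    show "\<forall>A\<in>S ` {..<m}. contraction_strip n m t A \<or> expansion_strip n m t A"
      using strip by blast
  qed
qed

lemma markov_exists:
  fixes n :: nat and t :: "circle \<Rightarrow> circle"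
  assumes "0 < n" "t \<in> PL_plus"
    and rat: "\<And>x. rational_point x \<Longrightarrow> rational_point (t x)"
    and "\<And>x. break_point t x \<Longrightarrow> rational_point x"
    and powers: "\<And>x D. has_circle_derivative t D x \<Longrightarrow> \<exists>q :: int. D = real n powi q"
  shows "\<exists>m>0. markov n m t"
proof -
  obtain F where F: "circle_lift t F" "piecewise_linear t"
    using assms(2) by (auto simp: PL_plus_def orientation_preserving_def)
  obtain M \<sigma> where M: "0 < M"
    and affine: "\<And>j x. j < M \<Longrightarrow> x \<in> {real j / M..(real j + 1) / M} \<Longrightarrow>
      F x = F (real j / M) + \<sigma> j * (x - real j / M)"
    and der: "\<And>j. j < M \<Longrightarrow> \<exists>x. (F has_real_derivative \<sigma> j) (at x)"
    using affine_on_rational_grid[OF F assms(4)] by blast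
  have "\<exists>q :: int. \<sigma> j = real n powi q" if "j < M" for j
    using der[OF that] powers F(1) unfolding has_circle_derivative_def by blast
  then obtain q :: "nat \<Rightarrow> int" where q: "\<And>j. j < M \<Longrightarrow> \<sigma> j = real n powi q j" by metis
  define k where "k j = nat (q j)" for j
  define e where "e j = nat (- q j)" for j
  have slope: "\<sigma> j = real n ^ k j / real n ^ e j" if "j < M" for j
    using q[OF that] by (simp add: k_def e_def power_int_def field_simps)
  have "finite ((\<lambda>j. F (real j / M)) ` {..<M})" by simp
  moreover have "F (real j / M) \<in> \<rat>" for j
  proof -
    have "rational_point (to_circle (real j / M))" by (simp add: rational_point_def)
    then have "rational_point (to_circle (F (real j / M)))"
      using rat F(1) by (metis circle_lift_def)
    then obtain y where "y \<in> \<rat>" "F (real j / M) - y \<in> \<int>"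
      by (auto simp: rational_point_def to_circle_eq_iff)
    then have "(F (real j / M) - y) + y \<in> \<rat>" using Ints_subset_Rats by (intro Rats_add) auto
    then show ?thesis by simp
  qed
  then have "(\<lambda>j. F (real j / M)) ` {..<M} \<subseteq> \<rat>" by blast
  ultimately obtain B where B: "0 < B" "\<And>x. x \<in> (\<lambda>j. F (real j / M)) ` {..<M} \<Longrightarrow> real B * x \<in> \<int>"
    by (rule common_denominator) blast
  define L where "L = (\<Sum>j<M. e j)"
  have e_le: "e j \<le> L" if "j < M" for j
    unfolding L_def using that by (intro member_le_sum) auto
  have "markov n (M * (B * n ^ L)) t"
  proof (rule markov_if_affine_on_grid[OF M _ assms(1) F(1)])
    show "0 < B * n ^ L" using B assms(1) by simp
    show "e j = 0 \<or> k j = 0" for j by (cases "0 \<le> q j") (simp_all add: e_def k_def)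
    show "n ^ e j dvd B * n ^ L" if "j < M" for j
      using e_le[OF that] by (intro dvd_mult le_imp_power_dvd)
    show "real (M * (B * n ^ L)) * F (real j / M) \<in> \<int>" if "j < M" for j
    proof -
      have "real (M * n ^ L) * (real B * F (real j / M)) \<in> \<int>"
        using that by (intro Ints_mult[OF Ints_of_nat] B(2)) auto
      then show ?thesis by (simp add: mult_ac)
    qed
    show "F x = F (real j / M) + (real n ^ k j / real n ^ e j) * (x - real j / M)"
      if "j < M" "x \<in> {real j / M..(real j + 1) / M}" for j x
      unfolding slope[OF that(1), symmetric] by (rule affine[OF that])
  qed
  then show ?thesis using M B assms(1) by (intro exI[of _ "M * (B * n ^ L)"]) simp
qed

section \<open>The linear pieces around a grid interval\<close>

lemma midpoint_in_consecutive_intervals: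
  assumes "0 < m" and "to_circle ((of_int q + 1/2) / real m) \<in> consecutive_intervals m p l"
  obtains j w where "q = p + int j + int m * w" "j < l"
proof -
  from assms(2) obtain j z where j: "j < l"
    and z: "real_of_int (p + int j) / real m \<le> z" "z \<le> (real_of_int (p + int j) + 1) / real m"
    and eq: "to_circle ((of_int q + 1/2) / real m) = to_circle z"
    by (auto simp: consecutive_intervals_def subdivision_interval_def)
  from eq obtain w :: int where "(of_int q + 1/2) / real m - z = of_int w"
    by (auto simp: to_circle_eq_iff elim: Ints_cases)
  then have mz: "real m * z = of_int q + 1/2 - real m * of_int w"
    using assms(1) by (simp add: field_simps)
  have "of_int (p + int j) \<le> real m * z" "real m * z \<le> of_int (p + int j) + 1"
    using z assms(1) by (simp_all add: field_simps)
  then have "real_of_int (p + int j) < of_int (q - int m * w) + 1"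
    "real_of_int (q - int m * w) < of_int (p + int j) + 1"
    by (simp_all add: mz)
  then have "q = p + int j + int m * w" by linarith
  then show thesis using j that by blast
qed

text \<open>In units of \<open>1 / m\<close>, both kinds of strip have the form of a run of \<open>n ^ a\<close> intervals, starting at
  \<open>p\<close>, that is mapped with slope \<open>n ^ b / n ^ a\<close>: a contraction has \<open>b = 0\<close> and an expansion
  \<open>a = 0\<close>.  The strip is lifted to the real line so that it covers the interval from \<open>q\<close> to
  \<open>q + 1\<close> itself, not only one congruent to it modulo \<open>m\<close>.\<close>

lemma markov_piece:
  assumes "0 < m" "markov n m t"
  shows "\<exists>p r a b. (a = 0 \<or> b = 0) \<and> p \<le> q \<and> q < p + int n ^ a \<and>
    (\<forall>v\<in>{0..real n ^ a}. t (to_circle ((of_int p + v) / m)) =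
       to_circle ((of_int r + v * real n ^ b / real n ^ a) / m))"
proof -
  have shift: "to_circle ((of_int (p + int m * w) + v) / m) = to_circle ((of_int p + v) / m)"
    for p w :: int and v :: real
  proof -
    have "(of_int (p + int m * w) + v) / m = (of_int p + v) / m + of_int w"
      using assms(1) by (simp add: field_simps)
    then show ?thesis by (simp only: to_circle_add_int Ints_of_int)
  qed
  from assms(2) obtain \<S> where cover: "\<Union>\<S> = UNIV"
    and strips: "\<forall>S\<in>\<S>. contraction_strip n m t S \<or> expansion_strip n m t S"
    unfolding markov_def by (elim exE conjE)
  obtain S where S: "S \<in> \<S>" "to_circle ((of_int q + 1/2) / real m) \<in> S"
    using cover UNIV_I by (metis UnionE)
  from strips S(1) have "contraction_strip n m t S \<or> expansion_strip n m t S" by simp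
  then show ?thesis
  proof
    assume "contraction_strip n m t S"
    then obtain p r k where Seq: "S = consecutive_intervals m p (n ^ k)"
      and lin: "linear_on_arc t (of_int p / m) ((of_int p + real n ^ k) / m)
                  (of_int r / m) (1 / real n ^ k)"
      unfolding contraction_strip_def by blast
    obtain j w where j: "q = p + int j + int m * w" "j < n ^ k"
      using midpoint_in_consecutive_intervals[OF assms(1)] S(2) Seq by blast
    have "t (to_circle ((of_int (p + int m * w) + v) / m)) =
            to_circle ((of_int r + v * real n ^ 0 / real n ^ k) / m)"
      if "v \<in> {0..real n ^ k}" for v
    proof -
      have "(of_int p + v) / m \<in> {of_int p / m .. (of_int p + real n ^ k) / m}"
        using that assms(1) by (simp add: divide_right_mono)
      with lin have "t (to_circle ((of_int p + v) / m)) =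
          to_circle (of_int r / m + 1 / real n ^ k * ((of_int p + v) / m - of_int p / m))"
        unfolding linear_on_arc_def by (rule bspec)
      also have "of_int r / m + 1 / real n ^ k * ((of_int p + v) / m - of_int p / m)
          = (of_int r + v * real n ^ 0 / real n ^ k) / m"
        by (simp add: add_divide_distrib)
      finally show ?thesis unfolding shift .
    qed
    moreover have "p + int m * w \<le> q" "q < p + int m * w + int n ^ k"
      using j by (auto simp flip: of_nat_power)
    ultimately show ?thesis by blast
  next
    assume "expansion_strip n m t S"
    then obtain p r k where Seq: "S = subdivision_interval m p"
      and lin: "linear_on_arc t (of_int p / m) ((of_int p + 1) / m) (of_int r / m) (real n ^ k)"
      unfolding expansion_strip_def by blast
    have "S = consecutive_intervals m p 1"
      by (simp add: Seq consecutive_intervals_def lessThan_Suc)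
    then obtain j w where j: "q = p + int j + int m * w" "j < 1"
      using midpoint_in_consecutive_intervals[OF assms(1)] S(2) by blast
    have "t (to_circle ((of_int (p + int m * w) + v) / m)) =
            to_circle ((of_int r + v * real n ^ k / real n ^ 0) / m)"
      if "v \<in> {0..real n ^ 0}" for v
    proof -
      have "(of_int p + v) / m \<in> {of_int p / m .. (of_int p + 1) / m}"
        using that assms(1) by (simp add: divide_right_mono)
      with lin have "t (to_circle ((of_int p + v) / m)) =
          to_circle (of_int r / m + real n ^ k * ((of_int p + v) / m - of_int p / m))"
        unfolding linear_on_arc_def by (rule bspec)
      also have "of_int r / m + real n ^ k * ((of_int p + v) / m - of_int p / m)
          = (of_int r + v * real n ^ k / real n ^ 0) / m"
        by (simp add: add_divide_distrib)
      finally show ?thesis unfolding shift .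
    qed
    moreover have "p + int m * w \<le> q" "q < p + int m * w + int n ^ 0"
      using j by auto
    ultimately show ?thesis by blast
  qed
qed

section \<open>The orbit of a grid point and its denominators\<close>

text \<open>A choice of such a piece for every \<open>q\<close>: the run of \<open>n ^ a q\<close> intervals that starts at \<open>p q\<close> is
  mapped to an arc that starts at \<open>r q\<close>.\<close>

locale markov_pieces =
  fixes n m :: nat and t :: "circle \<Rightarrow> circle" and p r :: "int \<Rightarrow> int" and a b :: "int \<Rightarrow> nat"
  assumes n_pos: "0 < n" and m_pos: "0 < m"
    and one_sided: "a q = 0 \<or> b q = 0"
    and in_piece: "p q \<le> q" "q < p q + int n ^ a q"
    and affine: "v \<in> {0..real n ^ a q} \<Longrightarrow>
      t (to_circle ((of_int (p q) + v) / m)) =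
        to_circle ((of_int (r q) + v * real n ^ b q / real n ^ a q) / m)"
begin

text \<open>A lift of the orbit of the grid point \<open>0\<close>, in units of \<open>1 / m\<close>.\<close>

primrec orbit :: "nat \<Rightarrow> real" where
  "orbit 0 = 0"
| "orbit (Suc i) = (let q = \<lfloor>orbit i\<rfloor> in
     of_int (r q) + (orbit i - of_int (p q)) * real n ^ b q / real n ^ a q)"

text \<open>A bound for the exponent of \<open>n\<close> in the denominator of the orbit point.  A contraction raises it and
  an expansion lowers it; the truncation of the subtraction at \<open>0\<close> is intended, because an
  expansion of an integer gives an integer.\<close>

primrec level :: "nat \<Rightarrow> nat" where
  "level 0 = 0"
| "level (Suc i) = level i + a \<lfloor>orbit i\<rfloor> - b \<lfloor>orbit i\<rfloor>"

lemma n_nonzero [simp]: "n \<noteq> 0" "0 < n"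
  using n_pos by simp_all

lemma piece_room: "of_int q + 1 \<le> of_int (p q) + real n ^ a q"
  using in_piece(2)[of q]
  by (metis int_less_real_le of_int_add of_int_of_nat_eq of_int_power)

lemma t_orbit: "(t ^^ i) (to_circle 0) = to_circle (orbit i / m)"
proof (induction i)
  case (Suc i)
  define q where "q = \<lfloor>orbit i\<rfloor>"
  have "real_of_int q + 1 \<le> of_int (p q) + real n ^ a q"
    by (rule piece_room)
  moreover have "of_int q \<le> orbit i" "orbit i < of_int q + 1" "real_of_int (p q) \<le> of_int q"
    using in_piece(1)[of q] by (simp_all add: q_def)
  ultimately have "orbit i - of_int (p q) \<in> {0..real n ^ a q}" by simp
  from affine[OF this] show ?case by (simp add: Suc q_def Let_def)
qed simp

lemma orbit_level: "orbit i * real n ^ level i \<in> \<int>"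
proof (induction i)
  case (Suc i)
  define q where "q = \<lfloor>orbit i\<rfloor>"
  define e' where "e' = level i + a q - b q"
  have "a q + level i \<le> b q + e'" unfolding e'_def by linarith
  then obtain d where d: "b q + e' = a q + level i + d" by (auto simp: le_iff_add)
  have "(orbit i - of_int (p q)) * real n ^ b q / real n ^ a q * real n ^ e'
      = (orbit i - of_int (p q)) * real n ^ (b q + e') / real n ^ a q"
    by (simp add: power_add)
  also have "\<dots> = (orbit i * real n ^ level i - of_int (p q) * real n ^ level i) * real n ^ d"
    unfolding d power_add by (simp add: field_simps)
  finally have step: "(orbit i - of_int (p q)) * real n ^ b q / real n ^ a q * real n ^ e' = \<dots>" .
  have "orbit (Suc i) = of_int (r q) + (orbit i - of_int (p q)) * real n ^ b q / real n ^ a q"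
    "level (Suc i) = e'"
    by (simp_all add: Let_def q_def e'_def)
  then have "orbit (Suc i) * real n ^ level (Suc i) =
      of_int (r q) * real n ^ e' + (orbit i * real n ^ level i - of_int (p q) * real n ^ level i) * real n ^ d"
    by (simp only: distrib_right step)
  also have "\<dots> \<in> \<int>" using Suc.IH by (intro Ints_add Ints_mult[of "of_int _"] Ints_mult[of "_ - _"] Ints_diff Ints_power) auto
  finally show ?case .
qed simp

text \<open>Intervals of length \<open>1 / n ^ \<mu>\<close> whose ends are multiples of their length are nested or have
  disjoint interiors; this is the case of such an interval and a unit interval.\<close>

lemma adic_in_unit:
  fixes A :: real and \<mu> i :: nat
  defines "q \<equiv> \<lfloor>orbit i\<rfloor>"
  assumes A: "A * real n ^ \<mu> \<in> \<int>" "A \<le> orbit i" "orbit i < A + 1 / real n ^ \<mu>"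
  shows "of_int q \<le> A" "A + 1 / real n ^ \<mu> \<le> of_int q + 1"
proof -
  obtain z where z: "A * real n ^ \<mu> = of_int z" using A(1) by (elim Ints_cases)
  have q: "of_int q \<le> orbit i" "orbit i < of_int q + 1" by (simp_all add: q_def)
  have "real_of_int q < A + 1 / real n ^ \<mu>" "A < of_int q + 1" using q A by linarith+
  then have "of_int q * real n ^ \<mu> < of_int z + 1" "of_int z < (of_int q + 1) * real n ^ \<mu>"
    unfolding z[symmetric] using mult_strict_right_mono[of A "of_int q + 1" "real n ^ \<mu>"]
    by (simp_all add: field_simps)
  then have "real_of_int (q * int n ^ \<mu>) < of_int (z + 1)" "real_of_int z < of_int ((q + 1) * int n ^ \<mu>)"
    by simp_all
  then have "q * int n ^ \<mu> \<le> z" "z + 1 \<le> (q + 1) * int n ^ \<mu>" by linarith+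
  then have "real_of_int (q * int n ^ \<mu>) \<le> of_int z" "real_of_int (z + 1) \<le> of_int ((q + 1) * int n ^ \<mu>)"
    by linarith+
  then have "of_int q * real n ^ \<mu> \<le> of_int z" "of_int z + 1 \<le> (of_int q + 1) * real n ^ \<mu>"
    by simp_all
  then show "of_int q \<le> A" "A + 1 / real n ^ \<mu> \<le> of_int q + 1"
    unfolding z[symmetric] by (simp_all add: field_simps)
qed

text \<open>An \<open>n\<close>-adic interval around an orbit point lies in one piece, so \<open>t\<close> maps it linearly.  Its image is
  again an \<open>n\<close>-adic interval of length at most \<open>1\<close> as long as its exponent stays nonnegative,
  which is what the natural number \<open>\<mu>'\<close> expresses.\<close>

lemma adic_step:
  fixes A :: real and \<mu> \<mu>' i :: nat
  defines "q \<equiv> \<lfloor>orbit i\<rfloor>"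
  defines "A' \<equiv> of_int (r q) + (A - of_int (p q)) * real n ^ b q / real n ^ a q"
  assumes A: "A * real n ^ \<mu> \<in> \<int>" "A \<le> orbit i" "orbit i < A + 1 / real n ^ \<mu>"
    and lev: "\<mu>' + b q = \<mu> + a q"
  shows "A' * real n ^ \<mu>' \<in> \<int>" "A' \<le> orbit (Suc i)" "orbit (Suc i) < A' + 1 / real n ^ \<mu>'"
    and "\<And>w. w \<in> {0..1} \<Longrightarrow> t (to_circle ((A + w / real n ^ \<mu>) / m)) =
                       to_circle ((A' + w / real n ^ \<mu>') / m)"
proof -
  have pw: "real n ^ b q / real n ^ a q = real n ^ \<mu> / real n ^ \<mu>'"
    using arg_cong[OF lev, of "\<lambda>i. real n ^ i"] by (simp add: field_simps power_add)
  note qA = adic_in_unit[OF A, folded q_def]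
  have A'_eq: "A' = of_int (r q) + (A - of_int (p q)) * real n ^ \<mu> / real n ^ \<mu>'"
    unfolding A'_def times_divide_eq_right[symmetric] pw by simp
  have "A' * real n ^ \<mu>' = of_int (r q) * real n ^ \<mu>' + (A * real n ^ \<mu> - of_int (p q) * real n ^ \<mu>)"
    unfolding A'_eq by (simp add: field_simps)
  also have "\<dots> \<in> \<int>" using A(1) by (intro Ints_add Ints_diff Ints_mult[of "of_int _"] Ints_power) auto
  finally show "A' * real n ^ \<mu>' \<in> \<int>" .
  have orb: "orbit (Suc i) = A' + (orbit i - A) * real n ^ \<mu> / real n ^ \<mu>'"
  proof -
    have "orbit (Suc i) = of_int (r q) + (orbit i - of_int (p q)) * (real n ^ b q / real n ^ a q)"
      by (simp add: Let_def q_def)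
    then show ?thesis unfolding pw A'_eq by (simp add: left_diff_distrib diff_divide_distrib)
  qed
  show "A' \<le> orbit (Suc i)" unfolding orb using A(2) by simp
  have "(orbit i - A) * real n ^ \<mu> < 1" using A(3) by (simp add: field_simps)
  then show "orbit (Suc i) < A' + 1 / real n ^ \<mu>'"
    unfolding orb by (simp add: divide_strict_right_mono)
  fix w :: real assume w: "w \<in> {0..1}"
  let ?v = "A + w / real n ^ \<mu> - of_int (p q)"
  have "real_of_int q + 1 \<le> of_int (p q) + real n ^ a q"
    by (rule piece_room)
  moreover have "0 \<le> w / real n ^ \<mu>" "w / real n ^ \<mu> \<le> 1 / real n ^ \<mu>"
    using w by (simp_all add: divide_right_mono)
  moreover have "real_of_int (p q) \<le> of_int q" using in_piece(1)[of q] by simp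
  ultimately have "?v \<in> {0..real n ^ a q}" using qA by simp
  from affine[OF this] have "t (to_circle ((A + w / real n ^ \<mu>) / m)) =
      to_circle ((of_int (r q) + ?v * (real n ^ \<mu> / real n ^ \<mu>')) / m)"
    unfolding times_divide_eq_right[symmetric] pw by simp
  also have "of_int (r q) + ?v * (real n ^ \<mu> / real n ^ \<mu>') = A' + w / real n ^ \<mu>'"
    unfolding A'_eq by (simp add: field_simps)
  finally show "t (to_circle ((A + w / real n ^ \<mu>) / m)) = to_circle ((A' + w / real n ^ \<mu>') / m)" .
qed

section \<open>Blocks contracted along the orbit\<close>

text \<open>At time \<open>l\<close> a contraction lifts the level past \<open>h\<close>.  The contracted strip has \<open>n ^ a\<close> intervals, and
  inside it the intervals are grouped into aligned blocks of \<open>n ^ width h l\<close>.  The width is chosen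
  such that the image of a block has exponent \<open>level (Suc l) - Suc h\<close>: a block then remains an
  \<open>n\<close>-adic interval inside a unit interval for as long as the level stays above \<open>h\<close>.\<close>

definition climbs :: "nat \<Rightarrow> nat \<Rightarrow> bool" where
  "climbs h l \<longleftrightarrow> level l \<le> h \<and> h < level (Suc l)"

definition width :: "nat \<Rightarrow> nat \<Rightarrow> nat" where
  "width h l = Suc (h - level l)"

definition block :: "nat \<Rightarrow> nat \<Rightarrow> int" where
  "block h l = (let q = \<lfloor>orbit l\<rfloor>; W = int n ^ width h l in p q + W * ((q - p q) div W))"

lemma climbsD:
  assumes "climbs h l"
  shows "b \<lfloor>orbit l\<rfloor> = 0" "level (Suc l) = level l + a \<lfloor>orbit l\<rfloor>"
    "width h l \<le> a \<lfloor>orbit l\<rfloor>" "level (Suc l) - Suc h + width h l = a \<lfloor>orbit l\<rfloor>"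
proof -
  have *: "level l \<le> h" "h < level l + a \<lfloor>orbit l\<rfloor> - b \<lfloor>orbit l\<rfloor>"
    using assms by (simp_all add: climbs_def)
  then show b: "b \<lfloor>orbit l\<rfloor> = 0" using one_sided[of "\<lfloor>orbit l\<rfloor>"] by linarith
  then show lev: "level (Suc l) = level l + a \<lfloor>orbit l\<rfloor>" by simp
  show "width h l \<le> a \<lfloor>orbit l\<rfloor>" using * b unfolding width_def by linarith
  show "level (Suc l) - Suc h + width h l = a \<lfloor>orbit l\<rfloor>"
    using * b unfolding width_def lev by linarith
qed

lemma block_in_piece:
  assumes "climbs h l"
  defines "q \<equiv> \<lfloor>orbit l\<rfloor>" and "W \<equiv> int n ^ width h l"
  shows "0 \<le> block h l - p q" "W dvd block h l - p q" "block h l - p q + W \<le> int n ^ a q"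
    "block h l \<le> q" "q < block h l + W"
proof -
  define d where "d = (q - p q) div W"
  have W: "0 < W" by (simp add: W_def)
  have off: "block h l - p q = W * d"
    by (simp add: block_def Let_def d_def W_def q_def)
  have "0 \<le> d" using in_piece(1)[of q] W by (simp add: d_def pos_imp_zdiv_nonneg_iff)
  then show "0 \<le> block h l - p q" using W by (simp add: off)
  show "W dvd block h l - p q" by (simp add: off)
  have qd: "q - p q = W * d + (q - p q) mod W" by (simp add: d_def)
  moreover have "0 \<le> (q - p q) mod W" "(q - p q) mod W < W" using W by simp_all
  ultimately show *: "block h l \<le> q" "q < block h l + W" using off by linarith+
  define M where "M = int n ^ (a q - width h l)"
  have nM: "int n ^ a q = W * M"
    using climbsD(3)[OF assms(1)] by (simp add: W_def M_def q_def flip: power_add)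
  have "W * d < W * M" using in_piece(2)[of q] * off nM by linarith
  then have "d + 1 \<le> M" using W by simp
  then have "W * (d + 1) \<le> W * M" using W by (intro mult_left_mono) auto
  then show "block h l - p q + W \<le> int n ^ a q" by (simp add: off nM algebra_simps)
qed

lemma block_affine:
  assumes "climbs h l" "u \<in> {0..real n ^ width h l}"
  defines "q \<equiv> \<lfloor>orbit l\<rfloor>"
  shows "t (to_circle ((of_int (block h l) + u) / m)) =
    to_circle ((of_int (r q) + (of_int (block h l - p q) + u) / real n ^ a q) / m)"
proof -
  let ?s = "block h l - p q"
  have "0 \<le> ?s" "?s + int n ^ width h l \<le> int n ^ a q"
    using block_in_piece[OF assms(1)] by (simp_all add: q_def)
  then have "0 \<le> real_of_int ?s" "real_of_int (?s + int n ^ width h l) \<le> real_of_int (int n ^ a q)"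
    by linarith+
  then have "of_int ?s + u \<in> {0..real n ^ a q}" using assms(2) by simp
  from affine[OF this] show ?thesis
    using climbsD(1)[OF assms(1)] by (simp add: q_def)
qed

text \<open>The exponent of the image of the block at time \<open>j\<close> is the level minus \<open>Suc h\<close>, which is nonnegative
  by hypothesis, so that each step is an instance of the step for \<open>n\<close>-adic intervals.\<close>

lemma block_follow:
  assumes "l < j" "climbs h l" "\<And>i. l < i \<Longrightarrow> i \<le> j \<Longrightarrow> h < level i"
  shows "\<exists>A. A * real n ^ (level j - Suc h) \<in> \<int> \<and> A \<le> orbit j \<and>
      orbit j < A + 1 / real n ^ (level j - Suc h) \<and>
      (\<forall>w\<in>{0..1}. (t ^^ (j - l)) (to_circle ((of_int (block h l) + real n ^ width h l * w) / m)) =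
         to_circle ((A + w / real n ^ (level j - Suc h)) / m))"
  using assms(1,3)
proof (induction j)
  case (Suc j)
  show ?case
  proof (cases "j = l")
    case True
    define q where "q = \<lfloor>orbit l\<rfloor>"
    define s where "s = block h l - p q"
    define W where "W = real n ^ width h l"
    define V where "V = real n ^ (level (Suc l) - Suc h)"
    define A where "A = of_int (r q) + of_int s / real n ^ a q"
    have pos: "0 < W" "0 < V" by (simp_all add: W_def V_def)
    have nVW: "real n ^ a q = V * W"
      using climbsD(4)[OF assms(2)] by (simp add: V_def W_def q_def flip: power_add)
    obtain d where d: "s = int n ^ width h l * d"
      using block_in_piece(2)[OF assms(2)] by (auto simp: s_def q_def)
    have "A * V = of_int (r q) * V + of_int d"
      using pos by (simp add: A_def nVW d W_def[symmetric] field_simps)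
    then have A_int: "A * V \<in> \<int>" by (simp add: V_def)
    have orb: "orbit (Suc l) = of_int (r q) + (orbit l - of_int (p q)) / real n ^ a q"
      using climbsD(1)[OF assms(2)] by (simp add: Let_def q_def)
    have "block h l \<le> q" "q + 1 \<le> block h l + int n ^ width h l"
      using block_in_piece(4,5)[OF assms(2)] by (simp_all add: q_def)
    then have "real_of_int (block h l) \<le> of_int q"
      "real_of_int (q + 1) \<le> real_of_int (block h l + int n ^ width h l)" by linarith+
    moreover have "of_int q \<le> orbit l" "orbit l < of_int q + 1" by (simp_all add: q_def)
    ultimately have pos_s: "of_int s \<le> orbit l - of_int (p q)" "orbit l - of_int (p q) < of_int s + W"
      by (simp_all add: s_def W_def)
    have le: "A \<le> orbit (Suc l)"
      unfolding orb A_def using pos_s by (simp add: divide_right_mono)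
    have "(orbit l - of_int (p q)) / real n ^ a q < (of_int s + W) / real n ^ a q"
      using pos_s by (simp add: divide_strict_right_mono)
    also have "(of_int s + W) / real n ^ a q = of_int s / real n ^ a q + 1 / V"
      unfolding nVW using pos by (simp add: add_divide_distrib)
    finally have less: "orbit (Suc l) < A + 1 / V" unfolding orb A_def by simp
    have "(t ^^ (Suc j - l)) (to_circle ((of_int (block h l) + W * w) / m)) =
        to_circle ((A + w / V) / m)" if "w \<in> {0..1}" for w
    proof -
      have "W * w \<le> W * 1" using that pos by (intro mult_left_mono) auto
      then have "W * w \<in> {0..real n ^ width h l}" using that pos by (simp add: W_def)
      note block_affine[OF assms(2) this, folded q_def, folded s_def]
      also have "of_int (r q) + (of_int s + W * w) / real n ^ a q = A + w / V"
        unfolding A_def nVW using pos by (simp add: add_divide_distrib)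
      finally show ?thesis using True by (simp add: q_def s_def)
    qed
    then show ?thesis
      using A_int le less True unfolding V_def W_def by blast
  next
    case False
    define q where "q = \<lfloor>orbit j\<rfloor>"
    have "l < j" using False Suc.prems(1) by simp
    with Suc obtain A where A: "A * real n ^ (level j - Suc h) \<in> \<int>" "A \<le> orbit j"
        "orbit j < A + 1 / real n ^ (level j - Suc h)"
      and follow: "\<And>w. w \<in> {0..1} \<Longrightarrow>
        (t ^^ (j - l)) (to_circle ((of_int (block h l) + real n ^ width h l * w) / m)) =
         to_circle ((A + w / real n ^ (level j - Suc h)) / m)"
      by auto
    have "h < level j" "h < level (Suc j)"
      using Suc.prems(2)[of j] Suc.prems(2)[of "Suc j"] \<open>l < j\<close> by (simp_all del: level.simps)
    then have "level (Suc j) - Suc h + b q = level j - Suc h + a q"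
      unfolding level.simps q_def[symmetric] by linarith
    note step = adic_step[OF A this[unfolded q_def]]
    have "(t ^^ (Suc j - l)) (to_circle ((of_int (block h l) + real n ^ width h l * w) / m)) =
        t ((t ^^ (j - l)) (to_circle ((of_int (block h l) + real n ^ width h l * w) / m)))" for w
      using \<open>l < j\<close> by (simp add: Suc_diff_le)
    then show ?thesis
      using step follow by (intro exI conjI ballI) (assumption | simp only:)+
  qed
qed simp

text \<open>At time \<open>l'\<close> the image of the first block is contained in a unit interval around the orbit point,
  and the second block consists of whole unit intervals and contains that point.  If both blocks
  are the same arc of the circle, then an iterate of \<open>t\<close> maps this arc linearly into itself
  with slope less than \<open>1\<close> and has a fixed point there.\<close>

lemma block_return:
  assumes "2 \<le> n" "l < l'" "climbs h l" "climbs h' l'" "\<And>i. l < i \<Longrightarrow> i \<le> l' \<Longrightarrow> h < level i"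
    and "width h' l' = width h l" "block h' l' = block h l + int m * w"
  shows "\<exists>x. (t ^^ (l' - l)) x = x"
proof -
  define W where "W = real n ^ width h l"
  define V where "V = real n ^ (level l' - Suc h)"
  define q where "q = \<lfloor>orbit l'\<rfloor>"
  obtain A where A: "A * V \<in> \<int>" "A \<le> orbit l'" "orbit l' < A + 1 / V"
    and follow: "\<And>w. w \<in> {0..1} \<Longrightarrow> (t ^^ (l' - l)) (to_circle ((of_int (block h l) + W * w) / m)) =
         to_circle ((A + w / V) / m)"
    using block_follow[OF assms(2,3,5)] unfolding W_def V_def by blast
  have qA: "of_int q \<le> A" "A + 1 / V \<le> of_int q + 1"
    using adic_in_unit[OF A[unfolded V_def]] by (simp_all add: q_def V_def)
  have "block h' l' \<le> q" "q + 1 \<le> block h' l' + int n ^ width h l"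
    using block_in_piece(4,5)[OF assms(4)] assms(6) by (simp_all add: q_def)
  then have "real_of_int (block h' l') \<le> of_int q"
      "real_of_int (q + 1) \<le> real_of_int (block h' l' + int n ^ width h l)" by linarith+
  then have bq: "real_of_int (block h' l') \<le> of_int q" "of_int q + 1 \<le> real_of_int (block h' l') + W"
    by (simp_all add: W_def)
  have V: "1 \<le> V" using assms(1) by (simp add: V_def)
  have "real n ^ 1 \<le> W" using assms(1) unfolding W_def width_def by (intro power_increasing) auto
  then have W: "2 \<le> W" using assms(1) by simp
  have "1 / V \<le> 1" using V by simp
  then have gap: "0 < W - 1 / V" using W by linarith
  \<comment> \<open>The solution of \<open>A + w0 / V = block h' l' + W * w0\<close>, the equation for a fixed point.\<close>
  define w0 where "w0 = (A - of_int (block h' l')) / (W - 1 / V)"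
  have "0 \<le> w0" "w0 \<le> 1" using gap qA bq by (simp_all add: w0_def)
  then have "(t ^^ (l' - l)) (to_circle ((of_int (block h l) + W * w0) / m)) = to_circle ((A + w0 / V) / m)"
    by (intro follow) simp
  also have "w0 * (W - 1 / V) = A - of_int (block h' l')" using gap by (simp add: w0_def)
  then have "A + w0 / V = of_int (block h l) + W * w0 + real m * of_int w"
    unfolding assms(7) by (simp add: algebra_simps)
  then have "(A + w0 / V) / m = (of_int (block h l) + W * w0) / m + of_int w"
    using m_pos by (simp add: add_divide_distrib)
  then have "to_circle ((A + w0 / V) / m) = to_circle ((of_int (block h l) + W * w0) / m)"
    by (simp only: to_circle_add_int Ints_of_int)
  finally show ?thesis by blast
qed

text \<open>The end of the first of the \<open>n\<close> equal parts of a block.  For \<open>n \<ge> 2\<close> these points label the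
  blocks injectively: the aligned blocks of a strip of \<open>n ^ a\<close> intervals form an \<open>n\<close>-ary tree,
  different nodes of the tree have different split points, and all of these are grid points
  inside the strip.  Hence there are at most \<open>m\<close> blocks on the circle.\<close>

definition split_point :: "nat \<Rightarrow> nat \<Rightarrow> int" where
  "split_point h l = block h l + int n ^ (width h l - 1)"

lemma split_point_affine:
  assumes "2 \<le> n" "climbs h l" "v \<in> {0..1}"
  defines "q \<equiv> \<lfloor>orbit l\<rfloor>"
  shows "t (to_circle ((of_int (split_point h l) + v) / m)) =
    to_circle ((of_int (r q) + (of_int (split_point h l - p q) + v) / real n ^ a q) / m)"
proof -
  have "width h l = Suc (width h l - 1)" by (simp add: width_def)
  then have "real n ^ width h l = real n * real n ^ (width h l - 1)" by (metis power_Suc)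
  moreover have "2 * real n ^ (width h l - 1) \<le> real n * real n ^ (width h l - 1)"
    using assms(1) by (intro mult_right_mono) auto
  moreover have "1 \<le> real n ^ (width h l - 1)" using assms(1) by simp
  moreover have "0 \<le> v" "v \<le> 1" using assms(3) by simp_all
  ultimately have "real n ^ (width h l - 1) + v \<in> {0..real n ^ width h l}"
    unfolding atLeastAtMost_iff by linarith
  from block_affine[OF assms(2) this] show ?thesis
    by (simp add: split_point_def q_def algebra_simps)
qed

text \<open>Two pieces that contain the unit interval to the right of the same split point describe the same
  map there; comparing slopes gives equal exponents, and comparing values gives equal offsets in
  the strips modulo \<open>n ^ a q\<close>.\<close>

lemma split_point_determines_exponent:
  assumes "2 \<le> n" "climbs h l" "climbs h' l'" "split_point h' l' = split_point h l + int m * w"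
  defines "q \<equiv> \<lfloor>orbit l\<rfloor>" and "q' \<equiv> \<lfloor>orbit l'\<rfloor>"
  shows "a q = a q'" "int n ^ a q dvd (split_point h l - p q) - (split_point h' l' - p q')"
proof -
  define f where "f v = of_int (r q) + (of_int (split_point h l - p q) + v) / real n ^ a q" for v :: real
  define f' where "f' v = of_int (r q') + (of_int (split_point h' l' - p q') + v) / real n ^ a q'" for v :: real
  have int: "(f v - f' v) / m \<in> \<int>" if "v \<in> {0..1}" for v
  proof -
    have "(of_int (split_point h' l') + v) / m = (of_int (split_point h l) + v) / m + of_int w"
      using m_pos by (simp add: assms(4) field_simps)
    then have "to_circle ((of_int (split_point h' l') + v) / m) = to_circle ((of_int (split_point h l) + v) / m)"
      by (simp only: to_circle_add_int Ints_of_int)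
    then have "to_circle (f v / m) = to_circle (f' v / m)"
      using split_point_affine[OF assms(1,2) that] split_point_affine[OF assms(1,3) that]
      by (simp add: f_def f'_def q_def q'_def)
    then show ?thesis by (simp add: to_circle_eq_iff diff_divide_distrib)
  qed
  \<comment> \<open>The values at both ends of the unit interval agree modulo integers, so the slopes do as well,
    and they are too small to differ by a nonzero integer.\<close>
  define D where "D = (1 / real n ^ a q - 1 / real n ^ a q') / m"
  have "(f 1 - f' 1) / m - (f 0 - f' 0) / m \<in> \<int>" using int by (intro Ints_diff) auto
  also have "(f 1 - f' 1) / m - (f 0 - f' 0) / m = D"
    unfolding f_def f'_def D_def by (simp add: add_divide_distrib diff_divide_distrib)
  finally have "D \<in> \<int>" .
  have inv: "0 < 1 / real n ^ k" "1 / real n ^ k \<le> 1" for k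
    using assms(1) by simp_all
  have "\<bar>1 / real n ^ a q - 1 / real n ^ a q'\<bar> < 1"
    using inv[of "a q"] inv[of "a q'"] by linarith
  then have "\<bar>D\<bar> < 1" using m_pos by (simp add: D_def)
  with \<open>D \<in> \<int>\<close> have "D = 0" by (rule Ints_nonzero_abs_less1)
  then have "real n ^ a q = real n ^ a q'" using m_pos by (simp add: D_def)
  then show eq: "a q = a q'" using assms(1) by simp
  obtain z :: int where z: "(f 0 - f' 0) / m = of_int z" using int[of 0] by (auto elim: Ints_cases)
  then have "f 0 - f' 0 = of_int (m * z)" using m_pos by (simp add: field_simps)
  moreover have "f 0 - f' 0 =
      of_int (r q - r q') + of_int ((split_point h l - p q) - (split_point h' l' - p q')) / real n ^ a q"
    unfolding f_def f'_def eq[symmetric] by (simp add: diff_divide_distrib add_divide_distrib)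
  ultimately have "of_int ((split_point h l - p q) - (split_point h' l' - p q')) / real n ^ a q
      = real_of_int (m * z - r q + r q')"
    by simp
  then have "of_int ((split_point h l - p q) - (split_point h' l' - p q')) = of_int (m * z - r q + r q') * real n ^ a q"
    by (simp add: divide_eq_eq)
  also have "\<dots> = real_of_int ((m * z - r q + r q') * int n ^ a q)" by simp
  finally have "(split_point h l - p q) - (split_point h' l' - p q') = (m * z - r q + r q') * int n ^ a q"
    by (simp only: of_int_eq_iff)
  then show "int n ^ a q dvd (split_point h l - p q) - (split_point h' l' - p q')" by simp
qed

text \<open>The offset of a split point in its strip is divisible by \<open>n ^ (width h l - 1)\<close> and by no higher
  power of \<open>n\<close>, so it determines the width.\<close>

lemma split_point_width_not_less:
  assumes "2 \<le> n" "climbs h l" "climbs h' l'" "split_point h' l' = split_point h l + int m * w"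
  shows "\<not> width h l < width h' l'"
proof
  assume less: "width h l < width h' l'"
  define c where "c = width h l - 1"
  define q where "q = \<lfloor>orbit l\<rfloor>"
  define q' where "q' = \<lfloor>orbit l'\<rfloor>"
  let ?N = "int n ^ width h l"
  have "width h l \<le> a q" using climbsD(3)[OF assms(2)] by (simp add: q_def)
  then have "?N dvd int n ^ a q" by (rule le_imp_power_dvd)
  then have 1: "?N dvd (split_point h l - p q) - (split_point h' l' - p q')"
    using split_point_determines_exponent(2)[OF assms] unfolding q_def q'_def by (rule dvd_trans)
  have 2: "?N dvd block h l - p q" using block_in_piece(2)[OF assms(2)] by (simp add: q_def)
  have "?N dvd int n ^ width h' l'" using less by (intro le_imp_power_dvd) simp
  then have 3: "?N dvd block h' l' - p q'"
    using block_in_piece(2)[OF assms(3)] unfolding q'_def by (rule dvd_trans)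
  have 4: "?N dvd int n ^ (width h' l' - 1)" using less by (intro le_imp_power_dvd) simp
  have "int n ^ c = ((split_point h l - p q) - (split_point h' l' - p q')) - (block h l - p q)
      + (block h' l' - p q') + int n ^ (width h' l' - 1)"
    by (simp add: split_point_def c_def)
  also have "?N dvd \<dots>" by (rule dvd_add[OF dvd_add[OF dvd_diff[OF 1 2] 3] 4])
  finally have "?N dvd int n ^ c" .
  then have "?N \<le> int n ^ c" by (rule zdvd_imp_le) simp
  moreover have "c < width h l" by (simp add: c_def width_def)
  then have "int n ^ c < ?N" using assms(1) by (intro power_strict_increasing) auto
  ultimately show False by simp
qed

lemma split_point_determines_block:
  assumes "2 \<le> n" "climbs h l" "climbs h' l'" "split_point h' l' = split_point h l + int m * w"
  shows "width h' l' = width h l" "block h' l' = block h l + int m * w"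
proof -
  have "split_point h l = split_point h' l' + int m * (- w)" using assms(4) by simp
  then have "\<not> width h' l' < width h l" by (rule split_point_width_not_less[OF assms(1,3,2)])
  with split_point_width_not_less[OF assms] show eq: "width h' l' = width h l" by simp
  then show "block h' l' = block h l + int m * w" using assms(4) by (simp add: split_point_def)
qed

section \<open>Bounding the period\<close>

text \<open>For each of the \<open>m + 1\<close> values \<open>h \<le> m\<close>, the last time up to \<open>i\<close> at which the level is at most \<open>h\<close>
  is a time at which a contraction lifts the level past \<open>h\<close>, and it gives a block.  There are at most \<open>m\<close>
  blocks, so two values of \<open>h\<close> give the same block.\<close>

lemma return_if_level_exceeds:
  assumes "2 \<le> n" "m < level i"
  shows "\<exists>j x. 0 < j \<and> j \<le> i \<and> (t ^^ j) x = x"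
proof -
  define L where "L h = Max {l. l \<le> i \<and> level l \<le> h}" for h
  have fin: "finite {l. l \<le> i \<and> level l \<le> h}" for h
    by (rule finite_subset[of _ "{..i}"]) auto
  have "0 \<in> {l. l \<le> i \<and> level l \<le> h}" for h by simp
  then have "L h \<in> {l. l \<le> i \<and> level l \<le> h}" for h
    unfolding L_def by (intro Max_in fin) blast
  then have L: "L h \<le> i" "level (L h) \<le> h" for h by blast+
  have above: "h < level l" if "L h < l" "l \<le> i" for h l
  proof (rule ccontr)
    assume "\<not> h < level l"
    then have "l \<in> {l. l \<le> i \<and> level l \<le> h}" using that by simp
    then have "l \<le> L h" unfolding L_def by (intro Max_ge fin)
    then show False using that by simp
  qed
  have L_less: "L h < i" if "h \<le> m" for h
    using L[of h] assms(2) that by (metis le_less_trans less_le_not_le nat_less_le)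
  have climb: "climbs h (L h)" if "h \<le> m" for h
    using L(2)[of h] above[of h "Suc (L h)"] L_less[OF that] by (simp add: climbs_def)
  define f where "f h = split_point h (L h) mod int m" for h
  have "f ` {..m} \<subseteq> {0..<int m}" using m_pos by (auto simp: f_def)
  then have "card (f ` {..m}) \<le> card {0..<int m}" by (intro card_mono) auto
  then have "\<not> inj_on f {..m}" by (intro pigeonhole) simp
  then obtain h h' where h: "h \<le> m" "h' \<le> m" "f h = f h'" "h < h'"
    unfolding inj_on_def by (metis atMost_iff linorder_neqE_nat)
  have "int m dvd split_point h' (L h') - split_point h (L h)"
    using h(3)[symmetric] by (simp add: f_def mod_eq_dvd_iff)
  then obtain w where w: "split_point h' (L h') = split_point h (L h) + int m * w"
    by (metis add.commute diff_add_cancel dvdE)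
  note eq = split_point_determines_block[OF assms(1) climb[OF h(1)] climb[OF h(2)] w]
  \<comment> \<open>Equal times and equal widths would give \<open>h = h'\<close>.\<close>
  have "L h \<noteq> L h'"
  proof
    assume "L h = L h'"
    then show False using eq(1) h(4) L(2)[of h] L(2)[of h'] by (simp add: width_def)
  qed
  moreover have "\<not> L h' < L h"
    using above[of h' "L h"] L[of h] h(4) by force
  ultimately have less: "L h < L h'" by simp
  have "\<exists>x. (t ^^ (L h' - L h)) x = x"
    using above L(1)[of h'] by (intro block_return[OF assms(1) less climb[OF h(1)] climb[OF h(2)] _ eq]) simp
  then show ?thesis
    using less L(1)[of h'] by (intro exI[of _ "L h' - L h"]) auto
qed

lemma return_if_grid_bounded:
  assumes "\<And>i. i \<le> n ^ m * m \<Longrightarrow> orbit i * real n ^ m \<in> \<int>"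
  shows "\<exists>j x. 0 < j \<and> j \<le> n ^ m * m \<and> (t ^^ j) x = x"
proof -
  define K where "K = n ^ m * m"
  define g where "g z = to_circle (real_of_int z / K)" for z
  define x where "x i = (t ^^ i) (to_circle 0)" for i
  have K: "0 < K" using m_pos by (simp add: K_def)
  have "x ` {..K} \<subseteq> g ` {0..<int K}"
  proof clarify
    fix i assume "i \<le> K"
    then obtain z where z: "orbit i * real n ^ m = of_int z"
      using assms by (auto simp: K_def elim: Ints_cases)
    have "real_of_int z = real_of_int (z mod K + int K * (z div K))" by simp
    also have "\<dots> = real_of_int (z mod K) + K * real_of_int (z div K)"
      by (simp only: of_int_add of_int_mult of_int_of_nat_eq)
    finally have "real_of_int z = real_of_int (z mod K) + K * real_of_int (z div K)" .
    then have "real_of_int z / K = real_of_int (z mod K) / K + real_of_int (z div K)"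
      using K by (simp add: field_simps)
    moreover have "orbit i / m = real_of_int z / K"
      using m_pos by (simp add: K_def field_simps flip: z)
    ultimately have "x i = g (z mod K)"
      unfolding x_def t_orbit g_def by (simp only: to_circle_add_int Ints_of_int)
    then show "x i \<in> g ` {0..<int K}" using K by simp
  qed
  then have "card (x ` {..K}) \<le> card (g ` {0..<int K})" by (intro card_mono) auto
  also have "\<dots> \<le> card {0..<int K}" by (intro card_image_le) auto
  finally have "\<not> inj_on x {..K}" by (intro pigeonhole) simp
  then obtain i j where ij: "i \<le> K" "j \<le> K" "x i = x j" "i < j"
    unfolding inj_on_def by (metis atMost_iff linorder_neqE_nat)
  have "(t ^^ (j - i)) (x i) = (t ^^ (j - i + i)) (to_circle 0)"
    by (simp only: x_def funpow_add comp_apply)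
  also have "\<dots> = x i" using ij by (simp add: x_def)
  finally have "(t ^^ (j - i)) (x i) = x i" .
  then show ?thesis using ij by (intro exI[of _ "j - i"] exI[of _ "x i"]) (auto simp: K_def)
qed

text \<open>The case \<open>n = 1\<close> falls under the first alternative, since then all orbit points are grid points.\<close>

lemma short_return:
  shows "\<exists>j x. 0 < j \<and> j \<le> n ^ m * m \<and> (t ^^ j) x = x"
proof (cases "\<forall>i \<le> n ^ m * m. orbit i * real n ^ m \<in> \<int>")
  case True
  then show ?thesis by (intro return_if_grid_bounded) simp
next
  case False
  then obtain i where i: "i \<le> n ^ m * m" "orbit i * real n ^ m \<notin> \<int>" by blast
  have "m < level i"
  proof (rule ccontr)
    assume "\<not> m < level i"
    then have "orbit i * real n ^ m = orbit i * real n ^ level i * real n ^ (m - level i)"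
      by (simp flip: power_add)
    also have "\<dots> \<in> \<int>" using orbit_level by (intro Ints_mult[of "_ * _"] Ints_power) auto
    finally show False using i by simp
  qed
  moreover have "n \<noteq> 1" using i orbit_level[of i] by auto
  then have "2 \<le> n" using n_pos by linarith
  ultimately show ?thesis using return_if_level_exceeds i(1) le_trans by metis
qed

end

lemma short_return_if_markov:
  assumes "0 < n" "0 < m" "markov n m t"
  shows "\<exists>j x. 0 < j \<and> j \<le> n ^ m * m \<and> (t ^^ j) x = x"
proof -
  let ?piece = "\<lambda>q p r a b. (a = 0 \<or> b = 0) \<and> p \<le> q \<and> q < p + int n ^ a \<and>
    (\<forall>v\<in>{0..real n ^ a}. t (to_circle ((of_int p + v) / m)) =
       to_circle ((of_int r + v * real n ^ b / real n ^ a) / m))"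
  have "\<forall>q. \<exists>p r a b. ?piece q p r a b" using markov_piece[OF assms(2,3)] by (rule allI)
  then obtain p r a b where piece: "\<forall>q. ?piece q (p q) (r q) (a q) (b q)"
    unfolding choice_iff by (elim exE)
  interpret markov_pieces n m t p r a b
  proof
    show "0 < n" "0 < m" by (fact assms)+
    fix q :: int and v :: real
    note q = spec[OF piece, of q]
    from q show "a q = 0 \<or> b q = 0" by (elim conjE)
    from q show "p q \<le> q" by (elim conjE)
    from q show "q < p q + int n ^ a q" by (elim conjE)
    assume v: "v \<in> {0..real n ^ a q}"
    from q have "\<forall>v\<in>{0..real n ^ a q}. t (to_circle ((of_int (p q) + v) / m)) =
        to_circle ((of_int (r q) + v * real n ^ b q / real n ^ a q) / m)"
      by (elim conjE)
    from this v show "t (to_circle ((of_int (p q) + v) / m)) =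
        to_circle ((of_int (r q) + v * real n ^ b q / real n ^ a q) / m)"
      by (rule bspec)
  qed
  show ?thesis by (rule short_return)
qed

theorem theoremA:
  fixes n m :: nat and t :: "circle \<Rightarrow> circle"
  assumes "n > 0"
    and "t \<in> PL_plus"
    and "\<And>x. rational_point x \<Longrightarrow> rational_point (t x)"
    and "\<And>x. break_point t x \<Longrightarrow> rational_point x"
    and "\<And>x D. has_circle_derivative t D x \<Longrightarrow> \<exists>q :: int. D = real n powi q"
    and "height n t = m"
  shows "\<exists>x. periodic_point t x \<and> period t x \<le> n ^ m * m"
proof -
  \<comment> \<open>The height is defined by a least element, which says something only if the set is nonempty.\<close>
  have "\<exists>m>0. markov n m t" using assms(1-5) by (rule markov_exists)
  then have "0 < m \<and> markov n m t"
    unfolding assms(6)[symmetric] height_def by (rule LeastI_ex)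
  then obtain j x where j: "0 < j" "j \<le> n ^ m * m" "(t ^^ j) x = x"
    using short_return_if_markov[OF assms(1)] by blast
  then have "period t x \<le> j" unfolding period_def by (intro Least_le) simp
  then show ?thesis using j unfolding periodic_point_def by (intro exI[of _ x]) auto
qed

end
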